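(* Let $0<\theta\le1$, $0\le\lambda<1$ and $\tau>0$. Then the adaptive algorithm (described in the context) terminates after finitely many iterations and provides some triangulation $\mathcal T'_\ell\in\mathrm{refine}(\mathcal T'_0)$ together with some discrete approximation $\psi_\ell\in\mathcal X_\ell$ to $\psi\in\mathcal H$ such that $$|||\psi-\psi_\ell|||\le C_{\rm stop}\,\tau,$$ where $C_{\rm stop}>0$ depends only on $C_{\rm rel}$ and $C_{\rm stab}$.
   Context: Meshes. Triangulations are conforming simplicial triangulations with a fixed refinement strategy: $\mathrm{refine}(\mathcal T,\mathcal M)$ is the coarsest refinement of $\mathcal T$ in which all marked elements $\mathcal M\subseteq\mathcal T$ are refined, so $\mathcal M\subseteq\mathcal T\setminus\mathrm{refine}(\mathcal T,\mathcal M)$; $\mathcal T_\circ\in\mathrm{refine}(\mathcal T_\bullet)$ means that $\mathcal T_\circ$ is obtained from $\mathcal T_\bullet$ by finitely many (possibly zero) such steps. Abstract framework. $\mathcal H$ is a (real) Hilbert space with scalar product $\langle\langle\cdot,\cdot\rangle\rangle$ and norm $|||\cdot|||$. Each triangulation $\mathcal T'_\bullet$ has an associated discrete (finite-dimensional) subspace $\mathcal X_\bullet\subseteq\mathcal H$, and $\mathcal T'_\circ\in\mathrm{refine}(\mathcal T'_\bullet)$ implies $\mathcal X_\bullet\subseteq\mathcal X_\circ$. Given $F\in\mathcal H^*$, $\psi\in\mathcal H$ is the solution of $\langle\langle\psi,\chi\rangle\rangle=F(\chi)$ for all $\chi\in\mathcal H$, and $\psi_\bullet^\star\in\mathcal X_\bullet$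 is its best approximation: $\langle\langle\psi_\bullet^\star,\chi_\bullet\rangle\rangle=F(\chi_\bullet)$ for all $\chi_\bullet\in\mathcal X_\bullet$. For each $\psi_\bullet\in\mathcal X_\bullet$ and $T\in\mathcal T'_\bullet$ a refinement indicator $\varrho_\bullet(T,\psi_\bullet)\ge0$ is given; $\varrho_\bullet(\mathcal U,\psi_\bullet):=\big(\sum_{T\in\mathcal U}\varrho_\bullet(T,\psi_\bullet)^2\big)^{1/2}$ for $\mathcal U\subseteq\mathcal T'_\bullet$, and $\varrho_\bullet(\psi_\bullet):=\varrho_\bullet(\mathcal T'_\bullet,\psi_\bullet)$. It is assumed that there are $C_{\rm stab},C_{\rm rel}>0$ and $0<q_{\rm red}<1$ such that for all $\mathcal T'_\bullet\in\mathrm{refine}(\mathcal T'_0)$, $\mathcal T'_\circ\in\mathrm{refine}(\mathcal T'_\bullet)$, $\psi_\bullet\in\mathcal X_\bullet$, $\psi_\circ\in\mathcal X_\circ$: (A1) $|\varrho_\circ(\mathcal T'_\circ\cap\mathcal T'_\bullet,\psi_\circ)-\varrho_\bullet(\mathcal T'_\circ\cap\mathcal T'_\bullet,\psi_\bullet)|\le C_{\rm stab}|||\psi_\circ-\psi_\bullet|||$; (A2) $\varrho_\circ(\mathcal T'_\circ\setminus\mathcal T'_\bullet,\psi_\bullet)^2\le q_{\rm red}\,\varrho_\bullet(\mathcal T'_\bullet\setminus\mathcal T'_\circ,\psi_\bullet)^2$; (A3) $|||\psi-\psi_\bullet^\star|||\le C_{\rm rel}\,\varrho_\bullet(\psi_\bullet^\star)$.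 Preconditioned CG. For a basis $\xi_1,\dots,\xi_N$ of $\mathcal X_\bullet$ let $S=(\langle\langle\xi_k,\xi_j\rangle\rangle)_{j,k}$, $b=(F(\xi_j))_j$. Let $P\in\mathbb R^{N\times N}$ be a symmetric positive definite optimal preconditioner: $c_P\,x^TPx\le x^TSx\le C_P\,x^TPx$ for all $x\in\mathbb R^N$, with $c_P,C_P>0$ independent of $\mathcal X_\bullet$. PCG denotes the standard preconditioned conjugate gradient method for $P^{-1}Sx^\star=P^{-1}b$, and $\psi_{\bullet,k}=\sum_jx_j^{(k)}\xi_j$ is the function corresponding to the $k$-th PCG iterate $x^{(k)}$. For $\psi_\bullet=\sum_jx_j\xi_j\in\mathcal X_\bullet$ put $|||\psi_\bullet^\star-\psi_\bullet|||_P^2:=(b-Sx)^TP^{-1}(b-Sx)$. Adaptive algorithm. Input: $0<\theta\le1$, $0\le\lambda<1$, initial triangulation $\mathcal T'_0$, initial guess $\psi_{-1}\in\mathcal X_0$, tolerance $\tau>0$. For $\ell=0,1,2,\dots$ iterate (i)--(iii) until $\varrho_\ell(\psi_\ell)^2+|||\psi_\ell^\star-\psi_\ell|||_P^2\le\tau^2$: (i) compute $\psi_\ell:=\psi_{\ell,k}\in\mathcal X_\ell$, where $k\in\mathbb N_0$ is the minimal number such that the $k$-th PCG iterate with initial guess $\psi_{\ell,0}:=\psi_{\ell-1}$ satisfies $|||\psi_\ell^\star-\psi_\ell|||^2\le\lambda\,|||\psi_\ell^\star-\psi_{\ell-1}|||^2$; (ii) determine $\mathcal M'_\ell\subseteq\mathcal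 T'_\ell$ with $\theta\,\varrho_\ell(\psi_\ell)^2\le\varrho_\ell(\mathcal M'_\ell,\psi_\ell)^2$; (iii) set $\mathcal T'_{\ell+1}:=\mathrm{refine}(\mathcal T'_\ell,\mathcal M'_\ell)$. Output: the smallest index $\ell$ satisfying the stopping criterion, with $\mathcal T'_\ell$ and $\psi_\ell$.
   Formalization: The constant C_stop may also depend on the lower preconditioner constant c_P (dependence on C_rel and C_stab alone fails when P is scaled), and it is chosen for a fixed Hilbert space H and a fixed Euclidean space containing the meshes. *)

theory Defs
  imports
    "HOL-Analysis.Analysis"
    "Jordan_Normal_Form.Gauss_Jordan_Elimination"
begin

unbundle no vec_syntax

section \<open>Triangulations and refinement\<close>

type_synonym 'a mesh = "'a set set"

text \<open>
  The predicate \<^const>\<open>triangulation\<close> requires finitely many simplices that intersect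
  pairwise in common faces, i.e. conformity.  It allows simplices of different dimensions,
  which is excluded here.
\<close>

definition simplicial_mesh :: "'a::euclidean_space mesh \<Rightarrow> bool" where
  "simplicial_mesh \<T> \<longleftrightarrow> triangulation \<T> \<and> (\<exists>d::nat. \<forall>K\<in>\<T>. int d simplex K)"

definition finer :: "'a mesh \<Rightarrow> 'a mesh \<Rightarrow> bool" where
  "finer \<T>' \<T> \<longleftrightarrow> \<Union>\<T>' = \<Union>\<T> \<and> (\<forall>K'\<in>\<T>'. \<exists>K\<in>\<T>. K' \<subseteq> K)"

inductive_set refinements :: "('a mesh \<Rightarrow> 'a mesh \<Rightarrow> 'a mesh) \<Rightarrow> 'a mesh \<Rightarrow> 'a mesh set"
  for refine :: "'a mesh \<Rightarrow> 'a mesh \<Rightarrow> 'a mesh" and \<T> :: "'a mesh" where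
  self: "\<T> \<in> refinements refine \<T>"
| step: "\<T>' \<in> refinements refine \<T> \<Longrightarrow> \<M> \<subseteq> \<T>' \<Longrightarrow> refine \<T>' \<M> \<in> refinements refine \<T>"

text \<open>
  The last two assumptions say that \<open>refine \<T> \<M>\<close> is the coarsest among the meshes which
  the strategy can generate from \<open>\<T>\<close> and in which all elements of \<open>\<M>\<close> are refined.
\<close>

locale refinement_strategy =
  fixes refine :: "'a::euclidean_space mesh \<Rightarrow> 'a mesh \<Rightarrow> 'a mesh" and \<T>\<^sub>0 :: "'a mesh"
  assumes initial_mesh: "simplicial_mesh \<T>\<^sub>0"
    and refine_mesh: "\<And>\<T> \<M>. \<T> \<in> refinements refine \<T>\<^sub>0 \<Longrightarrow> \<M> \<subseteq> \<T> \<Longrightarrow>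
          simplicial_mesh (refine \<T> \<M>)"
    and refine_finer: "\<And>\<T> \<M>. \<T> \<in> refinements refine \<T>\<^sub>0 \<Longrightarrow> \<M> \<subseteq> \<T> \<Longrightarrow>
          finer (refine \<T> \<M>) \<T>"
    and marked_refined: "\<And>\<T> \<M>. \<T> \<in> refinements refine \<T>\<^sub>0 \<Longrightarrow> \<M> \<subseteq> \<T> \<Longrightarrow>
          \<M> \<subseteq> \<T> - refine \<T> \<M>"
    and coarsest: "\<And>\<T> \<M> \<T>'. \<T> \<in> refinements refine \<T>\<^sub>0 \<Longrightarrow> \<M> \<subseteq> \<T> \<Longrightarrow>
          \<T>' \<in> refinements refine \<T> \<Longrightarrow> \<M> \<subseteq> \<T> - \<T>' \<Longrightarrow> finer \<T>' (refine \<T> \<M>)"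

section \<open>Galerkin approximation and refinement indicators\<close>

definition galerkin_solution :: "('h::real_inner \<Rightarrow> real) \<Rightarrow> 'h set \<Rightarrow> 'h \<Rightarrow> bool" where
  "galerkin_solution F V u \<longleftrightarrow> u \<in> V \<and> (\<forall>\<chi>\<in>V. inner u \<chi> = F \<chi>)"

definition estimator ::
  "('a mesh \<Rightarrow> 'a set \<Rightarrow> 'h \<Rightarrow> real) \<Rightarrow> 'a mesh \<Rightarrow> 'a mesh \<Rightarrow> 'h \<Rightarrow> real" where
  "estimator \<rho> \<T> \<U> v = sqrt (\<Sum>K\<in>\<U>. (\<rho> \<T> K v)\<^sup>2)"

locale abstract_framework = refinement_strategy refine \<T>\<^sub>0
  for refine :: "'a::euclidean_space mesh \<Rightarrow> 'a mesh \<Rightarrow> 'a mesh" and \<T>\<^sub>0 :: "'a mesh" +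
  fixes X :: "'a mesh \<Rightarrow> 'h::{real_inner, complete_space} set"
    and F :: "'h \<Rightarrow> real" and \<psi> :: 'h and \<psi>\<^sub>s :: "'a mesh \<Rightarrow> 'h"
    and \<rho> :: "'a mesh \<Rightarrow> 'a set \<Rightarrow> 'h \<Rightarrow> real"
    and C_stab q_red C_rel :: real
  assumes discrete_subspace: "\<And>\<T>. \<T> \<in> refinements refine \<T>\<^sub>0 \<Longrightarrow> subspace (X \<T>)"
    and discrete_finite_dim: "\<And>\<T>. \<T> \<in> refinements refine \<T>\<^sub>0 \<Longrightarrow> \<exists>B. finite B \<and> X \<T> = span B"
    and nested: "\<And>\<T> \<T>'. \<T> \<in> refinements refine \<T>\<^sub>0 \<Longrightarrow> \<T>' \<in> refinements refine \<T> \<Longrightarrow> X \<T> \<subseteq> X \<T>'"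
    and functional: "bounded_linear F"
    and solution: "galerkin_solution F UNIV \<psi>"
    and best_approximation:
      "\<And>\<T>. \<T> \<in> refinements refine \<T>\<^sub>0 \<Longrightarrow> galerkin_solution F (X \<T>) (\<psi>\<^sub>s \<T>)"
    and indicator_nonneg:
      "\<And>\<T> K v. \<T> \<in> refinements refine \<T>\<^sub>0 \<Longrightarrow> K \<in> \<T> \<Longrightarrow> v \<in> X \<T> \<Longrightarrow> 0 \<le> \<rho> \<T> K v"
    and constants: "0 < C_stab" "0 < C_rel" "0 < q_red" "q_red < 1"
    and stability: "\<And>\<T> \<T>' v v'. \<T> \<in> refinements refine \<T>\<^sub>0 \<Longrightarrow> \<T>' \<in> refinements refine \<T> \<Longrightarrow>
          v \<in> X \<T> \<Longrightarrow> v' \<in> X \<T>' \<Longrightarrow>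
          \<bar>estimator \<rho> \<T>' (\<T>' \<inter> \<T>) v' - estimator \<rho> \<T> (\<T>' \<inter> \<T>) v\<bar> \<le> C_stab * norm (v' - v)"
    and reduction: "\<And>\<T> \<T>' v. \<T> \<in> refinements refine \<T>\<^sub>0 \<Longrightarrow> \<T>' \<in> refinements refine \<T> \<Longrightarrow>
          v \<in> X \<T> \<Longrightarrow>
          (estimator \<rho> \<T>' (\<T>' - \<T>) v)\<^sup>2 \<le> q_red * (estimator \<rho> \<T> (\<T> - \<T>') v)\<^sup>2"
    and reliability: "\<And>\<T>. \<T> \<in> refinements refine \<T>\<^sub>0 \<Longrightarrow>
          norm (\<psi> - \<psi>\<^sub>s \<T>) \<le> C_rel * estimator \<rho> \<T> \<T> (\<psi>\<^sub>s \<T>)"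

section \<open>Preconditioned conjugate gradients\<close>

definition gram_matrix :: "'h::real_inner list \<Rightarrow> real mat" where
  "gram_matrix \<xi> = mat (length \<xi>) (length \<xi>) (\<lambda>(j, k). inner (\<xi> ! k) (\<xi> ! j))"

definition load_vector :: "('h \<Rightarrow> real) \<Rightarrow> 'h list \<Rightarrow> real Matrix.vec" where
  "load_vector F \<xi> = Matrix.vec (length \<xi>) (\<lambda>j. F (\<xi> ! j))"

definition coefficients :: "'h::real_inner list \<Rightarrow> 'h \<Rightarrow> real Matrix.vec" where
  "coefficients \<xi> v = Matrix.vec (length \<xi>) (\<lambda>j. representation (set \<xi>) v (\<xi> ! j))"

definition combination :: "'h::real_inner list \<Rightarrow> real Matrix.vec \<Rightarrow> 'h" where
  "combination \<xi> x = (\<Sum>j<length \<xi>. (x $ j) *\<^sub>R (\<xi> ! j))"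

text \<open>Only used for invertible matrices, for which \<^const>\<open>mat_inverse\<close> is not \<^const>\<open>None\<close>.\<close>

definition inverse_mat :: "real mat \<Rightarrow> real mat" where
  "inverse_mat P = the (mat_inverse P)"

text \<open>
  The state consists of iterate, residual and search direction.  If the residual vanishes, then
  \<open>0 / 0 = 0\<close> makes the iteration stationary at the exact solution.
\<close>

fun pcg_state ::
  "real mat \<Rightarrow> real Matrix.vec \<Rightarrow> real mat \<Rightarrow> real Matrix.vec \<Rightarrow> nat
    \<Rightarrow> real Matrix.vec \<times> real Matrix.vec \<times> real Matrix.vec" where
  "pcg_state S b P x\<^sub>0 0 = (let r = b - S *\<^sub>v x\<^sub>0 in (x\<^sub>0, r, inverse_mat P *\<^sub>v r))"
| "pcg_state S b P x\<^sub>0 (Suc k) =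
    (let (x, r, p) = pcg_state S b P x\<^sub>0 k;
         z = inverse_mat P *\<^sub>v r;
         \<alpha> = (r \<bullet> z) / (p \<bullet> (S *\<^sub>v p));
         r' = r - \<alpha> \<cdot>\<^sub>v (S *\<^sub>v p);
         z' = inverse_mat P *\<^sub>v r';
         \<beta> = (r' \<bullet> z') / (r \<bullet> z)
     in (x + \<alpha> \<cdot>\<^sub>v p, r', z' + \<beta> \<cdot>\<^sub>v p))"

definition pcg_iterate :: "('h::real_inner \<Rightarrow> real) \<Rightarrow> 'h list \<Rightarrow> real mat \<Rightarrow> 'h \<Rightarrow> nat \<Rightarrow> 'h" where
  "pcg_iterate F \<xi> P v k =
    combination \<xi> (fst (pcg_state (gram_matrix \<xi>) (load_vector F \<xi>) P (coefficients \<xi> v) k))"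

text \<open>The squared error of \<open>v\<close> in the norm induced by the preconditioner.\<close>

definition P_error_sq :: "('h::real_inner \<Rightarrow> real) \<Rightarrow> 'h list \<Rightarrow> real mat \<Rightarrow> 'h \<Rightarrow> real" where
  "P_error_sq F \<xi> P v =
    (let r = load_vector F \<xi> - gram_matrix \<xi> *\<^sub>v coefficients \<xi> v in r \<bullet> (inverse_mat P *\<^sub>v r))"

definition is_basis :: "'h::real_inner list \<Rightarrow> 'h set \<Rightarrow> bool" where
  "is_basis \<xi> V \<longleftrightarrow> distinct \<xi> \<and> independent (set \<xi>) \<and> span (set \<xi>) = V"

definition sym_pos_def :: "nat \<Rightarrow> real mat \<Rightarrow> bool" where
  "sym_pos_def n P \<longleftrightarrow> P \<in> carrier_mat n n \<and> transpose_mat P = P \<and>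
    (\<forall>x\<in>carrier_vec n. x \<noteq> 0\<^sub>v n \<longrightarrow> 0 < x \<bullet> (P *\<^sub>v x))"

locale pcg_framework = abstract_framework refine \<T>\<^sub>0 X F \<psi> \<psi>\<^sub>s \<rho> C_stab q_red C_rel
  for refine :: "'a::euclidean_space mesh \<Rightarrow> 'a mesh \<Rightarrow> 'a mesh" and \<T>\<^sub>0 :: "'a mesh"
    and X :: "'a mesh \<Rightarrow> 'h::{real_inner, complete_space} set"
    and F :: "'h \<Rightarrow> real" and \<psi> :: 'h and \<psi>\<^sub>s :: "'a mesh \<Rightarrow> 'h"
    and \<rho> :: "'a mesh \<Rightarrow> 'a set \<Rightarrow> 'h \<Rightarrow> real"
    and C_stab q_red C_rel :: real +
  fixes \<xi> :: "'a mesh \<Rightarrow> 'h list" and P :: "'a mesh \<Rightarrow> real mat" and c\<^sub>P C\<^sub>P :: real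
  assumes basis: "\<And>\<T>. \<T> \<in> refinements refine \<T>\<^sub>0 \<Longrightarrow> is_basis (\<xi> \<T>) (X \<T>)"
    and preconditioner: "\<And>\<T>. \<T> \<in> refinements refine \<T>\<^sub>0 \<Longrightarrow> sym_pos_def (length (\<xi> \<T>)) (P \<T>)"
    and P_constants: "0 < c\<^sub>P" "0 < C\<^sub>P"
    and optimal_lower: "\<And>\<T> x. \<T> \<in> refinements refine \<T>\<^sub>0 \<Longrightarrow> x \<in> carrier_vec (length (\<xi> \<T>)) \<Longrightarrow>
          c\<^sub>P * (x \<bullet> (P \<T> *\<^sub>v x)) \<le> x \<bullet> (gram_matrix (\<xi> \<T>) *\<^sub>v x)"
    and optimal_upper: "\<And>\<T> x. \<T> \<in> refinements refine \<T>\<^sub>0 \<Longrightarrow> x \<in> carrier_vec (length (\<xi> \<T>)) \<Longrightarrow>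
          x \<bullet> (gram_matrix (\<xi> \<T>) *\<^sub>v x) \<le> C\<^sub>P * (x \<bullet> (P \<T> *\<^sub>v x))"

section \<open>The adaptive algorithm\<close>

definition pcg_accepted ::
  "('h::real_inner \<Rightarrow> real) \<Rightarrow> 'h \<Rightarrow> 'h list \<Rightarrow> real mat \<Rightarrow> real \<Rightarrow> 'h \<Rightarrow> nat \<Rightarrow> bool" where
  "pcg_accepted F u\<^sub>s \<xi> P lam v k \<longleftrightarrow>
    (norm (u\<^sub>s - pcg_iterate F \<xi> P v k))\<^sup>2 \<le> lam * (norm (u\<^sub>s - v))\<^sup>2"

definition stopping ::
  "('a mesh \<Rightarrow> 'a set \<Rightarrow> 'h::real_inner \<Rightarrow> real) \<Rightarrow> ('h \<Rightarrow> real) \<Rightarrow> ('a mesh \<Rightarrow> 'h list)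
    \<Rightarrow> ('a mesh \<Rightarrow> real mat) \<Rightarrow> real \<Rightarrow> 'a mesh \<Rightarrow> 'h \<Rightarrow> bool" where
  "stopping \<rho> F \<xi> P \<tau> \<T> v \<longleftrightarrow> (estimator \<rho> \<T> \<T> v)\<^sup>2 + P_error_sq F (\<xi> \<T>) (P \<T>) v \<le> \<tau>\<^sup>2"

definition previous :: "'h \<Rightarrow> (nat \<Rightarrow> 'h) \<Rightarrow> nat \<Rightarrow> 'h" where
  "previous \<psi>_init \<psi>h l = (case l of 0 \<Rightarrow> \<psi>_init | Suc j \<Rightarrow> \<psi>h j)"

text \<open>
  The sequences \<open>\<T>h\<close>, \<open>\<psi>h\<close>, \<open>\<M>h\<close> of meshes, approximations and marked sets arise from an
  execution of the algorithm.  Marking is nondeterministic, hence a relation.  Sequence entries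
  after the stopping criterion has been met are unconstrained.  If the inner loop did not
  terminate, \<^const>\<open>Least\<close> would be a meaningless number; its termination is not assumed.
\<close>

definition adaptive_run ::
  "('a mesh \<Rightarrow> 'a mesh \<Rightarrow> 'a mesh) \<Rightarrow> 'a mesh \<Rightarrow> ('h::real_inner \<Rightarrow> real) \<Rightarrow> ('a mesh \<Rightarrow> 'h)
    \<Rightarrow> ('a mesh \<Rightarrow> 'a set \<Rightarrow> 'h \<Rightarrow> real) \<Rightarrow> ('a mesh \<Rightarrow> 'h list) \<Rightarrow> ('a mesh \<Rightarrow> real mat)
    \<Rightarrow> real \<Rightarrow> real \<Rightarrow> real \<Rightarrow> 'h
    \<Rightarrow> (nat \<Rightarrow> 'a mesh) \<Rightarrow> (nat \<Rightarrow> 'h) \<Rightarrow> (nat \<Rightarrow> 'a mesh) \<Rightarrow> bool" where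
  "adaptive_run refine \<T>\<^sub>0 F \<psi>\<^sub>s \<rho> \<xi> P \<theta> lam \<tau> \<psi>_init \<T>h \<psi>h \<M>h \<longleftrightarrow>
    \<T>h 0 = \<T>\<^sub>0 \<and>
    (\<forall>l. (\<forall>j<l. \<not> stopping \<rho> F \<xi> P \<tau> (\<T>h j) (\<psi>h j)) \<longrightarrow>
      \<psi>h l = pcg_iterate F (\<xi> (\<T>h l)) (P (\<T>h l)) (previous \<psi>_init \<psi>h l)
        (LEAST k. pcg_accepted F (\<psi>\<^sub>s (\<T>h l)) (\<xi> (\<T>h l)) (P (\<T>h l)) lam (previous \<psi>_init \<psi>h l) k)) \<and>
    (\<forall>l. (\<forall>j\<le>l. \<not> stopping \<rho> F \<xi> P \<tau> (\<T>h j) (\<psi>h j)) \<longrightarrow>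
      \<M>h l \<subseteq> \<T>h l \<and>
      \<theta> * (estimator \<rho> (\<T>h l) (\<T>h l) (\<psi>h l))\<^sup>2 \<le> (estimator \<rho> (\<T>h l) (\<M>h l) (\<psi>h l))\<^sup>2 \<and>
      \<T>h (Suc l) = refine (\<T>h l) (\<M>h l))"

end

theory Submission
  imports Defs "Jordan_Normal_Form.Determinant"
begin

unbundle no inner_syntax

text \<open>
  For \<open>lam = 0\<close> the inner loop only ends at the exact Galerkin solution, so a contraction estimate
  for the preconditioned conjugate gradient method does not suffice.  Instead, nonzero residuals
  give search directions that are orthogonal in the energy norm, and a finite-dimensional space
  only contains finitely many of these.

  If the outer loop never stopped, then the distance of successive best approximations would tend
  to zero, since their norms increase and are bounded.  The distance to the iterates contracts up to
  this perturbation and tends to zero, hence so do the increments of the iterates.  The estimator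
  then contracts up to these increments by stability, reduction and marking, and the
  preconditioner norm is bounded by the energy norm.  Thus the stopping quantity would tend to zero.
\<close>

section \<open>Conjugacy of the search directions\<close>

text \<open>
  The orthogonality relations of the conjugate gradient method only involve the numbers
  \<open>G i j = r\<^sub>i \<bullet> z\<^sub>j\<close>, \<open>R i j = r\<^sub>i \<bullet> p\<^sub>j\<close>, \<open>D i j = z\<^sub>i \<bullet> S p\<^sub>j\<close> and \<open>A i j = p\<^sub>i \<bullet> S p\<^sub>j\<close>.
\<close>

lemma conjugate_gradient_orthogonality:
  fixes G R A D :: "nat \<Rightarrow> nat \<Rightarrow> real" and \<alpha> \<beta> :: "nat \<Rightarrow> real"
  assumes G_sym: "\<And>i j. G i j = G j i" and A_sym: "\<And>i j. A i j = A j i"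
    and R_0: "\<And>i. R i 0 = G i 0"
    and R_direction: "\<And>i k. R i (Suc k) = G i (Suc k) + \<beta> k * R i k"
    and R_residual: "\<And>k j. R (Suc k) j = R k j - \<alpha> k * A k j"
    and A_direction: "\<And>k j. A (Suc k) j = D (Suc k) j + \<beta> k * A k j"
    and D_residual: "\<And>i j. \<alpha> j * D i j = G i j - G i (Suc j)"
    and \<alpha>: "\<And>k. \<alpha> k = G k k / A k k"
    and \<beta>: "\<And>k. \<beta> k = G (Suc k) (Suc k) / G k k"
    and G_nz: "\<And>k. G k k \<noteq> 0"
    and A_nz: "\<And>k. R k k \<noteq> 0 \<Longrightarrow> A k k \<noteq> 0"
  shows "A k k \<noteq> 0" and "i < k \<Longrightarrow> A k i = 0"
proof -
  \<comment> \<open>The orthogonality relations need each other, so one induction carries them all.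
    The identity \<open>R k k = G k k\<close> yields \<open>A k k \<noteq> 0\<close>, by which later
    stages divide.\<close>
  have "(\<forall>i<k. R k i = 0 \<and> G k i = 0 \<and> A k i = 0) \<and> R k k = G k k" for k
  proof (induction k rule: less_induct)
    case (less k)
    have A_nz': "A j j \<noteq> 0" if "j < k" for j
      using less[OF that] G_nz A_nz by metis
    then have \<alpha>_nz: "\<alpha> j \<noteq> 0" if "j < k" for j
      using that \<alpha> G_nz by simp
    show ?case
    proof (cases k)
      case 0
      then show ?thesis using R_0 by simp
    next
      case (Suc m)
      have m: "(\<forall>i<m. R m i = 0 \<and> G m i = 0 \<and> A m i = 0) \<and> R m m = G m m"
        using less Suc by simp
      \<comment> \<open>The step length \<open>\<alpha> m\<close> is chosen to remove the component
        along the newest direction. For older directions both terms of \<open>R_residual\<close>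
        vanish by induction.\<close>
      have R: "R k i = 0" if "i < k" for i
      proof (cases "i = m")
        case True
        then show ?thesis using R_residual[of m m] m \<alpha>[of m] A_nz'[of m] Suc by simp
      next
        case False
        then show ?thesis using R_residual[of m i] m that Suc by simp
      qed
      have G: "G k i = 0" if "i < k" for i
      proof (cases i)
        case 0
        then show ?thesis using R_0[of k] R[of 0] that by simp
      next
        case (Suc j)
        then show ?thesis using R_direction[of k j] R[of j] R[of i] that by simp
      qed
      have A: "A k i = 0" if "i < k" for i
      proof (cases "i = m")
        case True
        \<comment> \<open>Against the newest direction one term survives, and
          \<open>\<beta> m\<close> is chosen to cancel it.\<close>
        have "\<alpha> m * D k m = - G k k"
          using D_residual[of m k] G[of m] Suc by simp
        moreover have "\<alpha> m * (\<beta> m * A m m) = G k k"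
          using \<alpha>[of m] \<beta>[of m] A_nz'[of m] G_nz[of m] Suc by simp
        ultimately have "\<alpha> m * A k m = 0"
          using A_direction[of m m] Suc by (simp add: distrib_left)
        then show ?thesis using \<alpha>_nz[of m] Suc True by simp
      next
        case False
        then have "i < m" using that Suc by simp
        \<comment> \<open>Up to the factor \<open>\<alpha> i\<close>, the image of an older
          direction under \<open>S\<close> is a difference of residuals of index at most
          \<open>m\<close>, to which the new preconditioned residual is already orthogonal.\<close>
        then have "\<alpha> i * D k i = 0"
          using D_residual[of i k] G[of i] G[of "Suc i"] Suc by simp
        then have "D k i = 0" using \<alpha>_nz[OF that] by simp
        then show ?thesis using A_direction[of m i] m \<open>i < m\<close> Suc by simp
      qed
      have "R k k = G k k"
        using R_direction[of k m] R[of m] Suc by simp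
      with R G A show ?thesis by blast
    qed
  qed
  then show "A k k \<noteq> 0" and "i < k \<Longrightarrow> A k i = 0"
    using G_nz A_nz by metis+
qed

text \<open>Nonzero pairwise orthogonal vectors are distinct and independent, so a sequence of them
  would be an infinite independent set in a finite-dimensional span.\<close>

lemma finite_orthogonal_family:
  fixes w :: "nat \<Rightarrow> 'h::real_inner"
  assumes fin: "finite B" and span: "\<And>i. w i \<in> span B"
    and orth: "\<And>i j. i \<noteq> j \<Longrightarrow> inner (w i) (w j) = 0"
  shows "\<exists>i. w i = 0"
proof (rule ccontr)
  assume "\<nexists>i. w i = 0"
  then have nz: "w i \<noteq> 0" for i by blast
  have "inj w"
    using orth nz by (metis injI inner_eq_zero_iff)
  then have "infinite (range w)"
    using finite_imageD by blast
  moreover have "independent (range w)"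
  proof (rule pairwise_orthogonal_independent)
    show "pairwise real_inner_class.orthogonal (range w)"
    proof (rule pairwiseI)
      fix a b
      assume "a \<in> range w" "b \<in> range w" "a \<noteq> b"
      then obtain i j where "a = w i" "b = w j" "i \<noteq> j" by blast
      then show "real_inner_class.orthogonal a b"
        using orth by (simp add: real_inner_class.orthogonal_def)
    qed
    show "0 \<notin> range w" using nz by force
  qed
  then have "finite (range w)"
    using independent_span_bound[OF fin] span by blast
  ultimately show False by blast
qed

section \<open>Symmetric positive definite matrices\<close>

lemma scalar_prod_symmetric_mat:
  fixes A :: "real mat"
  assumes "A \<in> carrier_mat n n" "transpose_mat A = A" "x \<in> carrier_vec n" "y \<in> carrier_vec n"
  shows "x \<bullet> (A *\<^sub>v y) = y \<bullet> (A *\<^sub>v x)"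
  using transpose_vec_mult_scalar[of A n n y x] assms comm_scalar_prod[of y n "A *\<^sub>v x"]
  by simp

text \<open>Definiteness excludes a kernel, so the determinant is nonzero and
  \<open>mat_inverse\<close> succeeds. Transposing \<open>P * B = 1\<close> makes the transpose of
  \<open>B\<close> a left inverse of \<open>P\<close>, and inverses are unique.\<close>

lemma inverse_mat_spd:
  assumes "sym_pos_def n P"
  shows "inverse_mat P \<in> carrier_mat n n"
    and "P * inverse_mat P = 1\<^sub>m n"
    and "transpose_mat (inverse_mat P) = inverse_mat P"
proof -
  have P: "P \<in> carrier_mat n n" and sym: "transpose_mat P = P"
    and pos: "\<And>x. x \<in> carrier_vec n \<Longrightarrow> x \<noteq> 0\<^sub>v n \<Longrightarrow> 0 < x \<bullet> (P *\<^sub>v x)"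
    using assms by (auto simp: sym_pos_def_def)
  have "Determinant.det P \<noteq> 0"
    using det_0_iff_vec_prod_zero[OF P] pos by fastforce
  then obtain B where B: "mat_inverse P = Some B"
    using mat_inverse(1)[OF P] det_non_zero_imp_unit[OF P] by fastforce
  then have inv: "inverse_mat P = B" by (simp add: inverse_mat_def)
  have BP: "B \<in> carrier_mat n n" "P * B = 1\<^sub>m n" "B * P = 1\<^sub>m n"
    using mat_inverse(2)[OF P B] by auto
  then show "inverse_mat P \<in> carrier_mat n n" and "P * inverse_mat P = 1\<^sub>m n"
    using inv by auto
  have BT: "transpose_mat B \<in> carrier_mat n n" using BP by simp
  have "transpose_mat B * P = 1\<^sub>m n"
    using transpose_mult[OF P BP(1)] BP(2) sym by simp
  then have "transpose_mat B * (P * B) = B"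
    using assoc_mult_mat[OF BT P BP(1)] BP(1) by simp
  then have "transpose_mat B = B" using BP(2) BT by simp
  then show "transpose_mat (inverse_mat P) = inverse_mat P" using inv by simp
qed

lemma mult_inverse_mat_vec:
  assumes "sym_pos_def n P" and "x \<in> carrier_vec n"
  shows "P *\<^sub>v (inverse_mat P *\<^sub>v x) = x"
proof -
  have "P \<in> carrier_mat n n" using assms by (simp add: sym_pos_def_def)
  from assoc_mult_mat_vec[OF this inverse_mat_spd(1)[OF assms(1)] assms(2)] show ?thesis
    using inverse_mat_spd(2)[OF assms(1)] assms(2) by simp
qed

text \<open>With \<open>z = inverse_mat P *\<^sub>v x\<close>, the value in question is the
  quadratic form of \<open>P\<close> at \<open>z\<close>, and \<open>z\<close> is nonzero because
  \<open>P\<close> maps it to \<open>x\<close>.\<close>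

lemma inverse_mat_pos:
  assumes P: "sym_pos_def n P" and x: "x \<in> carrier_vec n" and nz: "x \<noteq> 0\<^sub>v n"
  shows "0 < x \<bullet> (inverse_mat P *\<^sub>v x)"
proof -
  define z where "z = inverse_mat P *\<^sub>v x"
  have z: "z \<in> carrier_vec n" "P *\<^sub>v z = x"
    using inverse_mat_spd(1)[OF P] x mult_inverse_mat_vec[OF P x] by (auto simp: z_def)
  have "P \<in> carrier_mat n n" using P by (simp add: sym_pos_def_def)
  then have "z \<noteq> 0\<^sub>v n" using z nz by auto
  then have "0 < z \<bullet> (P *\<^sub>v z)" using P z(1) unfolding sym_pos_def_def by blast
  then show ?thesis using z x comm_scalar_prod[of x n z] by (simp add: z_def)
qed

section \<open>The Galerkin system in coordinates\<close>

lemma gram_matrix_carrier [simp]: "gram_matrix \<xi> \<in> carrier_mat (length \<xi>) (length \<xi>)"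
  by (simp add: gram_matrix_def)

lemma load_vector_carrier [simp]: "load_vector F \<xi> \<in> carrier_vec (length \<xi>)"
  by (simp add: load_vector_def)

lemma coefficients_carrier [simp]: "coefficients \<xi> v \<in> carrier_vec (length \<xi>)"
  by (simp add: coefficients_def)

lemma gram_matrix_symmetric: "transpose_mat (gram_matrix \<xi>) = gram_matrix \<xi>"
  by (rule eq_matI) (auto simp: gram_matrix_def inner_commute)

lemma combination_in_span: "combination \<xi> x \<in> span (set \<xi>)"
  unfolding combination_def by (intro span_sum span_scale span_base) auto

lemma gram_matrix_vec:
  assumes "y \<in> carrier_vec (length \<xi>)" and "i < length \<xi>"
  shows "(gram_matrix \<xi> *\<^sub>v y) $ i = inner (combination \<xi> y) (\<xi> ! i)"
  using assms
  by (auto simp: gram_matrix_def combination_def scalar_prod_def inner_sum_left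
      lessThan_atLeast0 mult.commute intro!: sum.cong)

lemma inner_combination:
  assumes "x \<in> carrier_vec (length \<xi>)" and "y \<in> carrier_vec (length \<xi>)"
  shows "inner (combination \<xi> x) (combination \<xi> y) = x \<bullet> (gram_matrix \<xi> *\<^sub>v y)"
proof -
  have "x \<bullet> (gram_matrix \<xi> *\<^sub>v y) = (\<Sum>i<length \<xi>. x $ i * inner (combination \<xi> y) (\<xi> ! i))"
    using assms gram_matrix_vec[OF assms(2)]
    by (auto simp: scalar_prod_def lessThan_atLeast0 gram_matrix_def[of \<xi>] intro!: sum.cong)
  also have "\<dots> = inner (combination \<xi> x) (combination \<xi> y)"
    by (subst inner_commute) (simp add: combination_def[of \<xi> x] inner_sum_right)
  finally show ?thesis by simp
qed

lemma combination_diff: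
  assumes "x \<in> carrier_vec (length \<xi>)" and "y \<in> carrier_vec (length \<xi>)"
  shows "combination \<xi> (x - y) = combination \<xi> x - combination \<xi> y"
  using assms by (simp add: combination_def scaleR_left_diff_distrib sum_subtractf)

lemma combination_coefficients:
  assumes "is_basis \<xi> V" and "v \<in> V"
  shows "combination \<xi> (coefficients \<xi> v) = v"
proof -
  have \<xi>: "distinct \<xi>" "independent (set \<xi>)" "v \<in> span (set \<xi>)"
    using assms by (auto simp: is_basis_def)
  have "combination \<xi> (coefficients \<xi> v)
      = (\<Sum>j<length \<xi>. representation (set \<xi>) v (\<xi> ! j) *\<^sub>R (\<xi> ! j))"
    by (simp add: combination_def coefficients_def)
  also have "\<dots> = (\<Sum>u\<in>set \<xi>. representation (set \<xi>) v u *\<^sub>R u)"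
    by (rule sum.reindex_bij_betw) (rule bij_betw_nth[OF \<xi>(1)], auto)
  also have "\<dots> = v"
    by (rule real_vector.sum_representation_eq) (use \<xi> in auto)
  finally show ?thesis .
qed

lemma combination_eq_0:
  assumes "is_basis \<xi> V" and x: "x \<in> carrier_vec (length \<xi>)" and "combination \<xi> x = 0"
  shows "x = 0\<^sub>v (length \<xi>)"
proof -
  have \<xi>: "distinct \<xi>" "independent (set \<xi>)"
    using assms by (auto simp: is_basis_def)
  have inj: "inj_on ((!) \<xi>) {..<length \<xi>}"
    using \<xi>(1) by (simp add: inj_on_nth)
  \<comment> \<open>Independence speaks of coefficients attached to vectors, while \<open>x\<close>
    is indexed by list positions; distinctness of the list allows the transfer.\<close>
  define c where "c u = x $ (the_inv_into {..<length \<xi>} ((!) \<xi>) u)" for u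
  have c: "c (\<xi> ! i) = x $ i" if "i < length \<xi>" for i
    using inj that by (simp add: c_def the_inv_into_f_f)
  have "(\<Sum>u\<in>set \<xi>. c u *\<^sub>R u) = (\<Sum>i<length \<xi>. c (\<xi> ! i) *\<^sub>R (\<xi> ! i))"
    by (rule sum.reindex_bij_betw[symmetric]) (rule bij_betw_nth[OF \<xi>(1)], auto)
  also have "\<dots> = combination \<xi> x"
    by (simp add: combination_def c)
  finally have "(\<Sum>u\<in>set \<xi>. c u *\<^sub>R u) = 0" using assms by simp
  then have "c u = 0" if "u \<in> set \<xi>" for u
    using independentD[OF \<xi>(2) finite_set order_refl] that by blast
  then have "x $ i = 0" if "i < length \<xi>" for i
    using c that by (metis nth_mem)
  then show ?thesis using x by auto
qed

text \<open>The quadratic form is the squared energy norm of the function with coordinates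
  \<open>x\<close>, which vanishes only for zero coordinates.\<close>

lemma gram_matrix_pos:
  assumes "is_basis \<xi> V" and x: "x \<in> carrier_vec (length \<xi>)" and "x \<noteq> 0\<^sub>v (length \<xi>)"
  shows "0 < x \<bullet> (gram_matrix \<xi> *\<^sub>v x)"
  using combination_eq_0[OF assms(1,2)] assms(3) inner_combination[OF x x]
  by (metis inner_gt_zero_iff)

text \<open>Testing with the basis functions shows that the coordinates of \<open>u\<close> solve
  the linear system. This ties residuals, which the method computes, to errors.\<close>

lemma residual_galerkin:
  assumes \<xi>: "is_basis \<xi> V" and F: "bounded_linear F" and u: "galerkin_solution F V u"
    and y: "y \<in> carrier_vec (length \<xi>)"
  shows "load_vector F \<xi> - gram_matrix \<xi> *\<^sub>v y
    = gram_matrix \<xi> *\<^sub>v (coefficients \<xi> u - y)"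
proof -
  have "u \<in> V" and sol: "\<And>\<chi>. \<chi> \<in> V \<Longrightarrow> inner u \<chi> = F \<chi>"
    using u by (auto simp: galerkin_solution_def)
  have "\<xi> ! i \<in> V" if "i < length \<xi>" for i
    using \<xi> that by (metis is_basis_def nth_mem span_base)
  then have "(gram_matrix \<xi> *\<^sub>v coefficients \<xi> u) $ i = F (\<xi> ! i)" if "i < length \<xi>" for i
    using sol that combination_coefficients[OF \<xi> \<open>u \<in> V\<close>] by (simp add: gram_matrix_vec)
  then have "load_vector F \<xi> = gram_matrix \<xi> *\<^sub>v coefficients \<xi> u"
    by (intro eq_vecI) (simp_all add: load_vector_def gram_matrix_def[of \<xi>])
  then show ?thesis
    using y by (simp add: mult_minus_distrib_mat_vec[where nr = "length \<xi>" and nc = "length \<xi>"])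
qed

section \<open>Finite termination of the preconditioned conjugate gradient method\<close>

text \<open>If no residual vanished, the abstract orthogonality relations would apply at every index
  and produce infinitely many nonzero conjugate directions.\<close>

lemma pcg_state_terminates:
  fixes \<xi> :: "'h::real_inner list"
  defines "n \<equiv> length \<xi>" and "S \<equiv> gram_matrix \<xi>"
  assumes \<xi>: "is_basis \<xi> V" and P: "sym_pos_def n P"
    and b: "b \<in> carrier_vec n" and x\<^sub>0: "x\<^sub>0 \<in> carrier_vec n"
  shows "\<exists>k. fst (pcg_state S b P x\<^sub>0 k) \<in> carrier_vec n \<and>
    b - S *\<^sub>v fst (pcg_state S b P x\<^sub>0 k) = 0\<^sub>v n"
proof -
  define B where "B = inverse_mat P"
  define x r p where "x k = fst (pcg_state S b P x\<^sub>0 k)"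
    and "r k = fst (snd (pcg_state S b P x\<^sub>0 k))"
    and "p k = snd (snd (pcg_state S b P x\<^sub>0 k))" for k
  define z where "z k = B *\<^sub>v r k" for k
  define \<alpha> \<beta> where "\<alpha> k = (r k \<bullet> z k) / (p k \<bullet> (S *\<^sub>v p k))"
    and "\<beta> k = (r (Suc k) \<bullet> z (Suc k)) / (r k \<bullet> z k)" for k
  note state_defs = x_def r_def p_def z_def B_def
  have start: "x 0 = x\<^sub>0" "r 0 = b - S *\<^sub>v x\<^sub>0" "p 0 = z 0"
    by (simp_all add: state_defs Let_def)
  have x_Suc: "x (Suc k) = x k + \<alpha> k \<cdot>\<^sub>v p k"
    and r_Suc: "r (Suc k) = r k - \<alpha> k \<cdot>\<^sub>v (S *\<^sub>v p k)"
    and p_Suc: "p (Suc k) = z (Suc k) + \<beta> k \<cdot>\<^sub>v p k" for k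
    by (simp_all add: \<alpha>_def \<beta>_def state_defs Let_def split_def)
  have S: "S \<in> carrier_mat n n" "transpose_mat S = S"
    by (simp_all add: S_def n_def gram_matrix_symmetric)
  have B: "B \<in> carrier_mat n n" "transpose_mat B = B"
    using inverse_mat_spd[OF P] by (simp_all add: B_def)
  have "x k \<in> carrier_vec n \<and> r k \<in> carrier_vec n \<and> p k \<in> carrier_vec n" for k
  proof (induction k)
    case 0
    then show ?case using start S(1) B(1) b x\<^sub>0 by (auto simp: z_def)
  next
    case (Suc k)
    then show ?case using x_Suc r_Suc p_Suc S(1) B(1) by (auto simp: z_def)
  qed
  then have x: "x k \<in> carrier_vec n" and r: "r k \<in> carrier_vec n"
    and p: "p k \<in> carrier_vec n" for k by auto
  have z: "z k \<in> carrier_vec n" for k using r B(1) by (simp add: z_def)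
  have Sp: "S *\<^sub>v p k \<in> carrier_vec n" for k using S(1) p by simp
  \<comment> \<open>The recursively updated residual is the true one, so its vanishing means that
    \<open>x k\<close> solves the system.\<close>
  have residual: "r k = b - S *\<^sub>v x k" for k
  proof (induction k)
    case 0
    then show ?case using start by simp
  next
    case (Suc k)
    have "S *\<^sub>v x (Suc k) = S *\<^sub>v x k + \<alpha> k \<cdot>\<^sub>v (S *\<^sub>v p k)"
      using mult_add_distrib_mat_vec[OF S(1) x, of "\<alpha> k \<cdot>\<^sub>v p k" k] mult_mat_vec[OF S(1) p] p
      by (simp add: x_Suc)
    then show ?case
      using Suc b x p S(1) r_Suc by (intro eq_vecI) auto
  qed
  have "\<exists>k. r k = 0\<^sub>v n"
  proof (rule ccontr)
    assume "\<nexists>k. r k = 0\<^sub>v n"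
    then have G_pos: "0 < r k \<bullet> z k" for k
      using inverse_mat_pos[OF P r] by (simp add: z_def B_def)
    have Sym_S: "u \<bullet> (S *\<^sub>v v) = v \<bullet> (S *\<^sub>v u)" if "u \<in> carrier_vec n" "v \<in> carrier_vec n" for u v
      using scalar_prod_symmetric_mat[OF S that] .
    have G_sym: "r i \<bullet> z j = r j \<bullet> z i" for i j
      using scalar_prod_symmetric_mat[OF B r r] by (simp add: z_def)
    \<comment> \<open>That \<open>p k\<close> is nonzero is not known beforehand; it follows from
      \<open>r k \<bullet> p k \<noteq> 0\<close>, which the abstract induction provides.\<close>
    have A_nz: "p k \<bullet> (S *\<^sub>v p k) \<noteq> 0" if "r k \<bullet> p k \<noteq> 0" for k
    proof -
      have "p k \<noteq> 0\<^sub>v n" using that r[of k] by auto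
      then show ?thesis
        using gram_matrix_pos[OF \<xi>, of "p k"] p by (simp add: S_def n_def less_le)
    qed
    have R_direction: "r i \<bullet> p (Suc k) = r i \<bullet> z (Suc k) + \<beta> k * (r i \<bullet> p k)" for i k
      using scalar_prod_add_distrib[OF r z, of "\<beta> k \<cdot>\<^sub>v p k"] scalar_prod_smult_distrib[OF r p] p by (simp add: p_Suc)
    have R_residual: "r (Suc k) \<bullet> p j = r k \<bullet> p j - \<alpha> k * (p k \<bullet> (S *\<^sub>v p j))" for k j
      using minus_scalar_prod_distrib[OF r, of "\<alpha> k \<cdot>\<^sub>v (S *\<^sub>v p k)" "p j" k] p Sp
        smult_scalar_prod_distrib[OF Sp p] comm_scalar_prod[OF Sp p, of k j] Sym_S[OF p p, of k j]
      by (simp add: r_Suc)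
    have A_direction: "p (Suc k) \<bullet> (S *\<^sub>v p j)
        = z (Suc k) \<bullet> (S *\<^sub>v p j) + \<beta> k * (p k \<bullet> (S *\<^sub>v p j))" for k j
      using add_scalar_prod_distrib[OF z, of "\<beta> k \<cdot>\<^sub>v p k" "S *\<^sub>v p j" "Suc k"]
        smult_scalar_prod_distrib[OF p Sp] p Sp
      by (simp add: p_Suc)
    have D_residual: "\<alpha> j * (z i \<bullet> (S *\<^sub>v p j)) = r i \<bullet> z j - r i \<bullet> z (Suc j)" for i j
    proof -
      have "r (Suc j) \<bullet> z i = r j \<bullet> z i - \<alpha> j * ((S *\<^sub>v p j) \<bullet> z i)"
        using minus_scalar_prod_distrib[OF r, of "\<alpha> j \<cdot>\<^sub>v (S *\<^sub>v p j)" "z i" j] smult_scalar_prod_distrib[OF Sp z] Sp z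
        by (simp add: r_Suc)
      then show ?thesis
        using G_sym[of i j] G_sym[of i "Suc j"] comm_scalar_prod[OF Sp z, of j i] by simp
    qed
    note orthogonality = conjugate_gradient_orthogonality[where
        G = "\<lambda>i j. r i \<bullet> z j" and R = "\<lambda>i j. r i \<bullet> p j" and A = "\<lambda>i j. p i \<bullet> (S *\<^sub>v p j)"
        and D = "\<lambda>i j. z i \<bullet> (S *\<^sub>v p j)" and \<alpha> = \<alpha> and \<beta> = \<beta>,
        OF G_sym Sym_S[OF p p] _ R_direction R_residual A_direction D_residual \<alpha>_def \<beta>_def _ A_nz]
    have A_diag: "p k \<bullet> (S *\<^sub>v p k) \<noteq> 0" for k
      by (rule orthogonality(1)) (use G_pos start(3) in \<open>auto simp: less_le\<close>)
    have A_lower: "p k \<bullet> (S *\<^sub>v p i) = 0" if "i < k" for i k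
      by (rule orthogonality(2)) (use G_pos start(3) that in \<open>auto simp: less_le\<close>)
    \<comment> \<open>As functions, conjugate directions are orthogonal in the energy scalar product
      and all lie in the span of the basis.\<close>
    define w where "w k = combination \<xi> (p k)" for k
    have w: "inner (w i) (w j) = p i \<bullet> (S *\<^sub>v p j)" for i j
      using inner_combination[of "p i" \<xi> "p j"] p by (simp add: w_def S_def n_def)
    have "inner (w i) (w j) = 0" if "i \<noteq> j" for i j
      using that A_lower w inner_commute by (metis nat_neq_iff)
    then have "\<exists>k. w k = 0"
      using finite_orthogonal_family[of "set \<xi>" w] combination_in_span unfolding w_def by blast
    then show False using w A_diag by (metis inner_zero_left)
  qed
  then show ?thesis using x residual by (metis x_def)
qed

text \<open>A zero residual puts the coordinate error into the kernel of the Gram matrix, which is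
  trivial by definiteness.\<close>

lemma pcg_iterate_exact:
  assumes \<xi>: "is_basis \<xi> V" and P: "sym_pos_def (length \<xi>) P"
    and F: "bounded_linear F" and u: "galerkin_solution F V u"
  shows "\<exists>k. pcg_iterate F \<xi> P v k = u"
proof -
  obtain k y where y: "y = fst (pcg_state (gram_matrix \<xi>) (load_vector F \<xi>) P (coefficients \<xi> v) k)"
    "y \<in> carrier_vec (length \<xi>)" "load_vector F \<xi> - gram_matrix \<xi> *\<^sub>v y = 0\<^sub>v (length \<xi>)"
    using pcg_state_terminates[OF \<xi> P load_vector_carrier coefficients_carrier] by blast
  define e where "e = coefficients \<xi> u - y"
  have e: "e \<in> carrier_vec (length \<xi>)" using y by (simp add: e_def)
  have "gram_matrix \<xi> *\<^sub>v e = 0\<^sub>v (length \<xi>)"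
    using residual_galerkin[OF \<xi> F u y(2)] y(3) by (simp add: e_def)
  then have "e = 0\<^sub>v (length \<xi>)"
    using gram_matrix_pos[OF \<xi> e] e by fastforce
  then have "combination \<xi> e = 0" by (simp add: combination_def)
  moreover have "u \<in> V" using u by (simp add: galerkin_solution_def)
  ultimately have "combination \<xi> y = u"
    using combination_diff[OF coefficients_carrier y(2), of u]
      combination_coefficients[OF \<xi> \<open>u \<in> V\<close>] by (simp add: e_def)
  then show ?thesis using y(1) by (auto simp: pcg_iterate_def)
qed

section \<open>Equivalence of the preconditioner norm and the energy norm\<close>

lemma norm_diff_scaleR_sq:
  fixes x y :: "'h::real_inner"
  shows "(norm (x - a *\<^sub>R y))\<^sup>2 = (norm x)\<^sup>2 - 2 * (a * inner x y) + a * (a * (norm y)\<^sup>2)"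
  by (simp add: power2_norm_eq_inner inner_diff_left inner_diff_right inner_commute)

text \<open>Both bounds come from expanding a nonnegative square, so neither matrix square roots nor
  generalized eigenvalues appear. With \<open>r\<close> the residual and \<open>z\<close> the
  preconditioned residual, the two error quantities are \<open>z \<bullet> r\<close> and
  \<open>e \<bullet> r\<close>.\<close>

lemma P_error_sq_bounds:
  fixes \<xi> :: "'h::real_inner list"
  assumes \<xi>: "is_basis \<xi> V" and P: "sym_pos_def (length \<xi>) P"
    and F: "bounded_linear F" and u: "galerkin_solution F V u" and v: "v \<in> V"
    and c: "0 < c" and C: "0 < C"
    and lower: "\<And>x. x \<in> carrier_vec (length \<xi>) \<Longrightarrow>
      c * (x \<bullet> (P *\<^sub>v x)) \<le> x \<bullet> (gram_matrix \<xi> *\<^sub>v x)"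
    and upper: "\<And>x. x \<in> carrier_vec (length \<xi>) \<Longrightarrow>
      x \<bullet> (gram_matrix \<xi> *\<^sub>v x) \<le> C * (x \<bullet> (P *\<^sub>v x))"
  shows "c * (norm (u - v))\<^sup>2 \<le> P_error_sq F \<xi> P v"
    and "P_error_sq F \<xi> P v \<le> C * (norm (u - v))\<^sup>2"
proof -
  let ?n = "length \<xi>" and ?S = "gram_matrix \<xi>"
  define e where "e = coefficients \<xi> u - coefficients \<xi> v"
  define r where "r = ?S *\<^sub>v e"
  define z where "z = inverse_mat P *\<^sub>v r"
  have PC: "P \<in> carrier_mat ?n ?n" "transpose_mat P = P" using P by (auto simp: sym_pos_def_def)
  have e: "e \<in> carrier_vec ?n" by (simp add: e_def)
  have r: "r \<in> carrier_vec ?n"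
    unfolding r_def by (rule mult_mat_vec_carrier[OF gram_matrix_carrier e])
  have z: "z \<in> carrier_vec ?n" using inverse_mat_spd(1)[OF P] r by (simp add: z_def)
  have Pz: "P *\<^sub>v z = r" using mult_inverse_mat_vec[OF P r] by (simp add: z_def)
  have err: "P_error_sq F \<xi> P v = z \<bullet> r"
    using residual_galerkin[OF \<xi> F u coefficients_carrier] comm_scalar_prod[OF z r]
    by (simp add: P_error_sq_def Let_def z_def r_def e_def)
  have "u \<in> V" using u by (simp add: galerkin_solution_def)
  then have comb: "combination \<xi> e = u - v"
    using combination_diff[OF coefficients_carrier coefficients_carrier, of \<xi> u v]
      combination_coefficients[OF \<xi>] v by (simp add: e_def)
  have energy: "(norm (u - v))\<^sup>2 = e \<bullet> r"
    using inner_combination[OF e e] by (simp add: comb r_def power2_norm_eq_inner)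

  \<comment> \<open>The square in the form of \<open>P\<close> has cross term
    \<open>2 * c * (e \<bullet> r)\<close>, and \<open>lower\<close> absorbs half of it.\<close>
  have "0 \<le> (z - c \<cdot>\<^sub>v e) \<bullet> (P *\<^sub>v (z - c \<cdot>\<^sub>v e))"
  proof (cases "z - c \<cdot>\<^sub>v e = 0\<^sub>v ?n")
    case True
    then show ?thesis using PC by simp
  next
    case False
    then show ?thesis using P z e by (simp add: sym_pos_def_def less_imp_le)
  qed
  also have "P *\<^sub>v (z - c \<cdot>\<^sub>v e) = r - c \<cdot>\<^sub>v (P *\<^sub>v e)"
    using mult_minus_distrib_mat_vec[OF PC(1) z, of "c \<cdot>\<^sub>v e"] mult_mat_vec[OF PC(1) e] e Pz by simp
  also have "(z - c \<cdot>\<^sub>v e) \<bullet> (r - c \<cdot>\<^sub>v (P *\<^sub>v e))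
      = z \<bullet> r - c * (z \<bullet> (P *\<^sub>v e)) - (c * (e \<bullet> r) - c * (c * (e \<bullet> (P *\<^sub>v e))))"
    using minus_scalar_prod_distrib[OF z, of "c \<cdot>\<^sub>v e" "r - c \<cdot>\<^sub>v (P *\<^sub>v e)"]
      scalar_prod_minus_distrib[OF z r, of "c \<cdot>\<^sub>v (P *\<^sub>v e)"]
      scalar_prod_minus_distrib[OF e r, of "c \<cdot>\<^sub>v (P *\<^sub>v e)"] e r z mult_mat_vec_carrier[OF PC(1) e]
    by (simp add: right_diff_distrib)
  also have "z \<bullet> (P *\<^sub>v e) = e \<bullet> r"
    using scalar_prod_symmetric_mat[OF PC z e] Pz by simp
  finally have "2 * (c * (e \<bullet> r)) \<le> z \<bullet> r + c * (c * (e \<bullet> (P *\<^sub>v e)))" by simp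
  moreover have "c * (c * (e \<bullet> (P *\<^sub>v e))) \<le> c * (e \<bullet> r)"
    using lower[OF e] c by (simp add: r_def)
  ultimately show "c * (norm (u - v))\<^sup>2 \<le> P_error_sq F \<xi> P v"
    using err energy by simp

  \<comment> \<open>For the upper bound the square is taken in the energy norm, where
    \<open>upper\<close> controls the preconditioned residual as a function.\<close>
  define w where "w = combination \<xi> z"
  have "(norm w)\<^sup>2 \<le> C * (z \<bullet> r)"
    using upper[OF z] inner_combination[OF z z] Pz by (simp add: w_def power2_norm_eq_inner)
  moreover have wr: "inner w (u - v) = z \<bullet> r"
    using inner_combination[OF z e] by (simp add: w_def comb r_def)
  have "(norm (w - C *\<^sub>R (u - v)))\<^sup>2
      = (norm w)\<^sup>2 - 2 * (C * (z \<bullet> r)) + C * (C * (norm (u - v))\<^sup>2)"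
    using norm_diff_scaleR_sq[of w C "u - v"] wr by simp
  then have "0 \<le> (norm w)\<^sup>2 - 2 * (C * (z \<bullet> r)) + C * (C * (norm (u - v))\<^sup>2)"
    by (metis zero_le_power2)
  ultimately have "C * (z \<bullet> r) \<le> C * (C * (norm (u - v))\<^sup>2)" by linarith
  then show "P_error_sq F \<xi> P v \<le> C * (norm (u - v))\<^sup>2"
    using C err by simp
qed

section \<open>Convergence of the adaptive algorithm\<close>

text \<open>Once the perturbation is below \<open>\<epsilon> / 2 * (1 - q)\<close>, the recursion is
  dominated by an affine map with fixed point \<open>\<epsilon> / 2\<close>, and the excess over it
  decays geometrically.\<close>

lemma perturbed_contraction_tendsto_0:
  fixes a b :: "nat \<Rightarrow> real"
  assumes nonneg: "\<And>n. 0 \<le> a n" and q: "0 \<le> q" "q < 1"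
    and step: "\<And>n. a (Suc n) \<le> q * a n + b n" and b: "b \<longlonglongrightarrow> 0"
  shows "a \<longlonglongrightarrow> 0"
proof (rule LIMSEQ_I)
  fix \<epsilon> :: real
  assume \<epsilon>: "0 < \<epsilon>"
  then have "0 < \<epsilon> / 2 * (1 - q)" using q by simp
  then obtain N where N: "\<And>n. N \<le> n \<Longrightarrow> norm (b n) < \<epsilon> / 2 * (1 - q)"
    using LIMSEQ_D[OF b, of "\<epsilon> / 2 * (1 - q)"] by auto
  have bound: "a (N + m) \<le> q ^ m * a N + \<epsilon> / 2" for m
  proof (induction m)
    case 0
    then show ?case using \<epsilon> by simp
  next
    case (Suc m)
    have "a (N + Suc m) \<le> q * a (N + m) + \<epsilon> / 2 * (1 - q)"
      using step[of "N + m"] N[of "N + m"] by simp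
    also have "\<dots> \<le> q * (q ^ m * a N + \<epsilon> / 2) + \<epsilon> / 2 * (1 - q)"
      using mult_left_mono[OF Suc q(1)] by simp
    finally show ?case by (simp add: field_simps)
  qed
  have "(\<lambda>m. q ^ m * a N) \<longlonglongrightarrow> 0"
    by (rule tendsto_mult_left_zero) (rule LIMSEQ_power_zero, use q in simp)
  then obtain M where M: "\<And>m. M \<le> m \<Longrightarrow> norm (q ^ m * a N) < \<epsilon> / 2"
    using LIMSEQ_D[of _ 0 "\<epsilon> / 2"] \<epsilon> by fastforce
  have "norm (a n - 0) < \<epsilon>" if "N + M \<le> n" for n
  proof -
    have "N + (n - N) = n" and "M \<le> n - N" using that by auto
    then show ?thesis using bound[of "n - N"] M[of "n - N"] nonneg[of n] by simp
  qed
  then show "\<exists>no. \<forall>n\<ge>no. norm (a n - 0) < \<epsilon>" by blast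
qed

section \<open>Estimator reduction and increments of the best approximations\<close>

context abstract_framework
begin

text \<open>Sums over infinite sets are zero by convention, so splitting the estimator into parts
  relies on finiteness.\<close>

lemma finite_mesh:
  assumes "\<T> \<in> refinements refine \<T>\<^sub>0"
  shows "finite \<T>"
  using assms
proof cases
  case self
  then show ?thesis using initial_mesh by (simp add: simplicial_mesh_def triangulation_def)
next
  case (step \<T>' \<M>)
  then show ?thesis using refine_mesh by (simp add: simplicial_mesh_def triangulation_def)
qed

text \<open>For fixed \<open>v\<close> only the refined elements change. Reduction shrinks their
  contribution, and marking gives them at least the fraction \<open>\<theta>\<close> of the squared
  estimator. Taking roots before replacing \<open>v\<close> by \<open>v'\<close> avoids Young's
  inequality.\<close>

lemma estimator_reduction:
  assumes \<T>: "\<T> \<in> refinements refine \<T>\<^sub>0" and \<M>: "\<M> \<subseteq> \<T>" and "\<T>' = refine \<T> \<M>"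
    and v: "v \<in> X \<T>" and v': "v' \<in> X \<T>'" and \<theta>: "0 \<le> \<theta>" "\<theta> \<le> 1"
    and marking: "\<theta> * (estimator \<rho> \<T> \<T> v)\<^sup>2 \<le> (estimator \<rho> \<T> \<M> v)\<^sup>2"
  shows "estimator \<rho> \<T>' \<T>' v'
    \<le> sqrt (1 - (1 - q_red) * \<theta>) * estimator \<rho> \<T> \<T> v + C_stab * norm (v' - v)"
proof -
  have \<T>': "\<T>' \<in> refinements refine \<T>\<^sub>0" "\<T>' \<in> refinements refine \<T>"
    using assms by (auto intro: refinements.intros)
  have fin: "finite \<T>" "finite \<T>'" using finite_mesh \<T> \<T>' by auto
  have vX: "v \<in> X \<T>'" using nested[OF \<T> \<T>'(2)] v by blast
  have sq: "(estimator \<rho> \<S> \<U> u)\<^sup>2 = (\<Sum>K\<in>\<U>. (\<rho> \<S> K u)\<^sup>2)" for \<S> \<U> u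
    by (simp add: estimator_def sum_nonneg)
  have nonneg: "0 \<le> estimator \<rho> \<S> \<U> u" for \<S> \<U> u
    by (simp add: estimator_def sum_nonneg)
  have split': "(estimator \<rho> \<T>' \<T>' v)\<^sup>2
      = (estimator \<rho> \<T>' (\<T>' \<inter> \<T>) v)\<^sup>2 + (estimator \<rho> \<T>' (\<T>' - \<T>) v)\<^sup>2"
    unfolding sq by (rule sum.Int_Diff[OF fin(2)])
  have split: "(estimator \<rho> \<T> \<T> v)\<^sup>2
      = (estimator \<rho> \<T> (\<T>' \<inter> \<T>) v)\<^sup>2 + (estimator \<rho> \<T> (\<T> - \<T>') v)\<^sup>2"
    unfolding sq using sum.Int_Diff[OF fin(1), of _ \<T>'] by (simp add: Int_commute)
  \<comment> \<open>Stability with the same function on both meshes has right-hand side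
    zero.\<close>
  have same: "estimator \<rho> \<T>' (\<T>' \<inter> \<T>) v = estimator \<rho> \<T> (\<T>' \<inter> \<T>) v"
    using stability[OF \<T> \<T>'(2) v vX] by simp
  have "\<M> \<subseteq> \<T> - \<T>'" using marked_refined[OF \<T> \<M>] assms by simp
  then have "(estimator \<rho> \<T> \<M> v)\<^sup>2 \<le> (estimator \<rho> \<T> (\<T> - \<T>') v)\<^sup>2"
    unfolding sq by (intro sum_mono2) (use fin in auto)
  then have "(1 - q_red) * (\<theta> * (estimator \<rho> \<T> \<T> v)\<^sup>2)
      \<le> (1 - q_red) * (estimator \<rho> \<T> (\<T> - \<T>') v)\<^sup>2"
    using marking constants by (intro mult_left_mono) auto
  then have "(estimator \<rho> \<T>' \<T>' v)\<^sup>2 \<le> (1 - (1 - q_red) * \<theta>) * (estimator \<rho> \<T> \<T> v)\<^sup>2"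
    using split split' same reduction[OF \<T> \<T>'(2) v] by (simp add: algebra_simps)
  then have "estimator \<rho> \<T>' \<T>' v \<le> sqrt ((1 - (1 - q_red) * \<theta>) * (estimator \<rho> \<T> \<T> v)\<^sup>2)"
    by (rule real_le_rsqrt)
  also have "\<dots> = sqrt (1 - (1 - q_red) * \<theta>) * estimator \<rho> \<T> \<T> v"
    using nonneg by (simp add: real_sqrt_mult)
  finally have "estimator \<rho> \<T>' \<T>' v \<le> sqrt (1 - (1 - q_red) * \<theta>) * estimator \<rho> \<T> \<T> v" .
  \<comment> \<open>Here stability compares two functions on one mesh, viewed as its own refinement
    by zero steps.\<close>
  moreover have "\<bar>estimator \<rho> \<T>' \<T>' v' - estimator \<rho> \<T>' \<T>' v\<bar> \<le> C_stab * norm (v' - v)"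
    using stability[OF \<T>'(1) refinements.self vX v'] by simp
  ultimately show ?thesis by simp
qed

text \<open>Both Galerkin equations may be tested with the coarse solution, so the increment is
  orthogonal to it.\<close>

lemma best_approximation_pythagoras:
  assumes "\<T> \<in> refinements refine \<T>\<^sub>0" and "\<T>' \<in> refinements refine \<T>\<^sub>0" and "X \<T> \<subseteq> X \<T>'"
  shows "(norm (\<psi>\<^sub>s \<T>' - \<psi>\<^sub>s \<T>))\<^sup>2 = (norm (\<psi>\<^sub>s \<T>'))\<^sup>2 - (norm (\<psi>\<^sub>s \<T>))\<^sup>2"
proof -
  have "\<psi>\<^sub>s \<T> \<in> X \<T>" and "inner (\<psi>\<^sub>s \<T>') (\<psi>\<^sub>s \<T>) = inner (\<psi>\<^sub>s \<T>) (\<psi>\<^sub>s \<T>)"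
    using best_approximation[OF assms(1)] best_approximation[OF assms(2)] assms(3)
    by (auto simp: galerkin_solution_def)
  then show ?thesis
    by (simp add: power2_norm_eq_inner inner_diff_left inner_diff_right inner_commute)
qed

lemma best_approximation_norm_le:
  assumes "\<T> \<in> refinements refine \<T>\<^sub>0"
  shows "norm (\<psi>\<^sub>s \<T>) \<le> norm \<psi>"
proof -
  have "inner \<psi> (\<psi>\<^sub>s \<T>) = (norm (\<psi>\<^sub>s \<T>))\<^sup>2"
    using best_approximation[OF assms] solution
    by (auto simp: galerkin_solution_def power2_norm_eq_inner)
  then have "norm (\<psi>\<^sub>s \<T>) * norm (\<psi>\<^sub>s \<T>) \<le> norm \<psi> * norm (\<psi>\<^sub>s \<T>)"
    using norm_cauchy_schwarz[of \<psi> "\<psi>\<^sub>s \<T>"] by (simp add: power2_eq_square)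
  then show ?thesis by (cases "norm (\<psi>\<^sub>s \<T>) = 0") auto
qed

text \<open>
  By Galerkin orthogonality the squared increments telescope, so neither the closure of the union
  of the discrete spaces nor the limit of the best approximations is needed.
\<close>

lemma best_approximation_increments:
  assumes \<T>: "\<And>l. \<T>h l \<in> refinements refine \<T>\<^sub>0" and mono: "\<And>l. X (\<T>h l) \<subseteq> X (\<T>h (Suc l))"
  shows "(\<lambda>l. norm (\<psi>\<^sub>s (\<T>h (Suc l)) - \<psi>\<^sub>s (\<T>h l))) \<longlonglongrightarrow> 0"
proof -
  define s where "s l = (norm (\<psi>\<^sub>s (\<T>h l)))\<^sup>2" for l
  have incr: "(norm (\<psi>\<^sub>s (\<T>h (Suc l)) - \<psi>\<^sub>s (\<T>h l)))\<^sup>2 = s (Suc l) - s l" for l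
    using best_approximation_pythagoras[OF \<T> \<T> mono] by (simp add: s_def)
  have "s l \<le> s (Suc l)" for l
    using incr[of l] zero_le_power2[of "norm (\<psi>\<^sub>s (\<T>h (Suc l)) - \<psi>\<^sub>s (\<T>h l))"] by linarith
  then have "incseq s" by (rule incseq_SucI)
  moreover have "\<forall>l. s l \<le> (norm \<psi>)\<^sup>2"
    using best_approximation_norm_le[OF \<T>] by (simp add: s_def power_mono)
  ultimately obtain L where L: "s \<longlonglongrightarrow> L"
    by (rule incseq_convergent)
  have "(\<lambda>l. sqrt (s (Suc l) - s l)) \<longlonglongrightarrow> sqrt (L - L)"
    by (intro tendsto_intros LIMSEQ_Suc L)
  moreover have "sqrt (s (Suc l) - s l) = norm (\<psi>\<^sub>s (\<T>h (Suc l)) - \<psi>\<^sub>s (\<T>h l))" for l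
    unfolding incr[symmetric] by simp
  ultimately show ?thesis by simp
qed

end

section \<open>Termination of the algorithm and the error at the stop\<close>

context pcg_framework
begin

lemma P_error_sq_equivalence:
  assumes "\<T> \<in> refinements refine \<T>\<^sub>0" and "v \<in> X \<T>"
  shows "c\<^sub>P * (norm (\<psi>\<^sub>s \<T> - v))\<^sup>2 \<le> P_error_sq F (\<xi> \<T>) (P \<T>) v"
    and "P_error_sq F (\<xi> \<T>) (P \<T>) v \<le> C\<^sub>P * (norm (\<psi>\<^sub>s \<T> - v))\<^sup>2"
proof -
  note bounds = P_error_sq_bounds[OF basis[OF assms(1)] preconditioner[OF assms(1)] functional
      best_approximation[OF assms(1)] assms(2) P_constants
      optimal_lower[OF assms(1)] optimal_upper[OF assms(1)]]
  show "c\<^sub>P * (norm (\<psi>\<^sub>s \<T> - v))\<^sup>2 \<le> P_error_sq F (\<xi> \<T>) (P \<T>) v" by (rule bounds(1))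
  show "P_error_sq F (\<xi> \<T>) (P \<T>) v \<le> C\<^sub>P * (norm (\<psi>\<^sub>s \<T> - v))\<^sup>2" by (rule bounds(2))
qed

text \<open>The exact iterate is accepted even for \<open>lam = 0\<close>. Hence the
  \<open>Least\<close> number in \<open>adaptive_run\<close> does satisfy the acceptance
  criterion.\<close>

lemma pcg_accepted_exists:
  assumes "\<T> \<in> refinements refine \<T>\<^sub>0" and "0 \<le> lam"
  shows "\<exists>k. pcg_accepted F (\<psi>\<^sub>s \<T>) (\<xi> \<T>) (P \<T>) lam v k"
proof -
  obtain k where "pcg_iterate F (\<xi> \<T>) (P \<T>) v k = \<psi>\<^sub>s \<T>"
    using pcg_iterate_exact[OF basis preconditioner functional best_approximation, OF assms(1,1,1)]
    by metis
  then have "pcg_accepted F (\<psi>\<^sub>s \<T>) (\<xi> \<T>) (P \<T>) lam v k"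
    using assms(2) by (simp add: pcg_accepted_def)
  then show ?thesis ..
qed

lemma pcg_iterate_in_space:
  assumes "\<T> \<in> refinements refine \<T>\<^sub>0"
  shows "pcg_iterate F (\<xi> \<T>) (P \<T>) v k \<in> X \<T>"
  using basis[OF assms] combination_in_span by (auto simp: is_basis_def pcg_iterate_def)

text \<open>The error is split at the best approximation. Reliability bounds the first part by the
  estimator at \<open>\<psi>\<^sub>s \<T>\<close>, which stability compares with the one at
  \<open>v\<close>. The factor \<open>1 / sqrt c\<^sub>P\<close> converts the preconditioner norm of
  the criterion into the energy norm.\<close>

lemma error_le_stopping_quantity:
  assumes \<T>: "\<T> \<in> refinements refine \<T>\<^sub>0" and v: "v \<in> X \<T>" and \<tau>: "0 < \<tau>"
    and stop: "stopping \<rho> F \<xi> P \<tau> \<T> v"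
  shows "norm (\<psi> - v) \<le> (C_rel + (1 + C_rel * C_stab) / sqrt c\<^sub>P) * \<tau>"
proof -
  have lower: "c\<^sub>P * (norm (\<psi>\<^sub>s \<T> - v))\<^sup>2 \<le> P_error_sq F (\<xi> \<T>) (P \<T>) v"
    using P_error_sq_equivalence(1)[OF \<T> v] .
  moreover have "0 \<le> c\<^sub>P * (norm (\<psi>\<^sub>s \<T> - v))\<^sup>2" using P_constants by simp
  \<comment> \<open>Both summands of the stopping quantity are nonnegative, so each is at most
    \<open>\<tau>\<^sup>2\<close>.\<close>
  ultimately have est_sq: "(estimator \<rho> \<T> \<T> v)\<^sup>2 \<le> \<tau>\<^sup>2"
    and err_sq: "c\<^sub>P * (norm (\<psi>\<^sub>s \<T> - v))\<^sup>2 \<le> \<tau>\<^sup>2"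
    using stop zero_le_power2[of "estimator \<rho> \<T> \<T> v"] unfolding stopping_def by linarith+
  have est: "estimator \<rho> \<T> \<T> v \<le> \<tau>" using est_sq \<tau> power2_le_imp_le by fastforce
  have "(sqrt c\<^sub>P * norm (\<psi>\<^sub>s \<T> - v))\<^sup>2 \<le> \<tau>\<^sup>2"
    using err_sq P_constants by (simp add: power_mult_distrib)
  then have "sqrt c\<^sub>P * norm (\<psi>\<^sub>s \<T> - v) \<le> \<tau>" using \<tau> power2_le_imp_le by fastforce
  then have err: "norm (\<psi>\<^sub>s \<T> - v) \<le> \<tau> / sqrt c\<^sub>P"
    using P_constants by (simp add: field_simps)
  have "\<psi>\<^sub>s \<T> \<in> X \<T>" using best_approximation[OF \<T>] by (simp add: galerkin_solution_def)
  then have "estimator \<rho> \<T> \<T> (\<psi>\<^sub>s \<T>) \<le> estimator \<rho> \<T> \<T> v + C_stab * norm (\<psi>\<^sub>s \<T> - v)"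
    using stability[OF \<T> refinements.self v] by fastforce
  also have "\<dots> \<le> \<tau> + C_stab * (\<tau> / sqrt c\<^sub>P)"
    using est err constants by (intro add_mono mult_left_mono) auto
  finally have "C_rel * estimator \<rho> \<T> \<T> (\<psi>\<^sub>s \<T>) \<le> C_rel * (\<tau> + C_stab * (\<tau> / sqrt c\<^sub>P))"
    using constants by (intro mult_left_mono) auto
  then have "norm (\<psi> - \<psi>\<^sub>s \<T>) \<le> C_rel * (\<tau> + C_stab * (\<tau> / sqrt c\<^sub>P))"
    using reliability[OF \<T>] by simp
  moreover have "norm (\<psi> - v) \<le> norm (\<psi> - \<psi>\<^sub>s \<T>) + norm (\<psi>\<^sub>s \<T> - v)"
    using norm_triangle_ineq[of "\<psi> - \<psi>\<^sub>s \<T>" "\<psi>\<^sub>s \<T> - v"] by simp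
  ultimately have "norm (\<psi> - v) \<le> C_rel * (\<tau> + C_stab * (\<tau> / sqrt c\<^sub>P)) + \<tau> / sqrt c\<^sub>P"
    using err by simp
  then show ?thesis by (simp add: divide_inverse algebra_simps)
qed

text \<open>A run is constrained only until it stops, hence the condition on all
  \<open>j < l\<close>; the entry at the stopping index itself is still covered.\<close>

lemma adaptive_run_step:
  assumes run: "adaptive_run refine \<T>\<^sub>0 F \<psi>\<^sub>s \<rho> \<xi> P \<theta> lam \<tau> \<psi>_init \<T>h \<psi>h \<M>h"
    and lam: "0 \<le> lam"
    and running: "\<forall>j<l. \<not> stopping \<rho> F \<xi> P \<tau> (\<T>h j) (\<psi>h j)"
  shows "\<T>h l \<in> refinements refine \<T>\<^sub>0" and "\<psi>h l \<in> X (\<T>h l)"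
    and "(norm (\<psi>\<^sub>s (\<T>h l) - \<psi>h l))\<^sup>2 \<le> lam * (norm (\<psi>\<^sub>s (\<T>h l) - previous \<psi>_init \<psi>h l))\<^sup>2"
proof -
  show \<T>: "\<T>h l \<in> refinements refine \<T>\<^sub>0"
    using running
  proof (induction l)
    case 0
    then show ?case using run by (simp add: adaptive_run_def refinements.self)
  next
    case (Suc l)
    then have "\<M>h l \<subseteq> \<T>h l \<and> \<T>h (Suc l) = refine (\<T>h l) (\<M>h l)"
      using run by (auto simp: adaptive_run_def less_Suc_eq_le)
    then show ?case using Suc by (simp add: refinements.step)
  qed
  define v where "v = previous \<psi>_init \<psi>h l"
  define k where "k = (LEAST k. pcg_accepted F (\<psi>\<^sub>s (\<T>h l)) (\<xi> (\<T>h l)) (P (\<T>h l)) lam v k)"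
  have iterate: "\<psi>h l = pcg_iterate F (\<xi> (\<T>h l)) (P (\<T>h l)) v k"
    using run running unfolding adaptive_run_def v_def k_def by blast
  then show "\<psi>h l \<in> X (\<T>h l)" using pcg_iterate_in_space[OF \<T>] by simp
  have "pcg_accepted F (\<psi>\<^sub>s (\<T>h l)) (\<xi> (\<T>h l)) (P (\<T>h l)) lam v k"
    unfolding k_def by (rule LeastI_ex[OF pcg_accepted_exists[OF \<T> lam]])
  then show "(norm (\<psi>\<^sub>s (\<T>h l) - \<psi>h l))\<^sup>2
      \<le> lam * (norm (\<psi>\<^sub>s (\<T>h l) - previous \<psi>_init \<psi>h l))\<^sup>2"
    by (simp add: pcg_accepted_def iterate v_def)
qed

lemma adaptive_run_stops:
  assumes run: "adaptive_run refine \<T>\<^sub>0 F \<psi>\<^sub>s \<rho> \<xi> P \<theta> lam \<tau> \<psi>_init \<T>h \<psi>h \<M>h"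
    and \<theta>: "0 < \<theta>" "\<theta> \<le> 1" and lam: "0 \<le> lam" "lam < 1" and \<tau>: "0 < \<tau>"
  shows "\<exists>l. stopping \<rho> F \<xi> P \<tau> (\<T>h l) (\<psi>h l)"
proof (rule ccontr)
  assume "\<nexists>l. stopping \<rho> F \<xi> P \<tau> (\<T>h l) (\<psi>h l)"
  then have never: "\<not> stopping \<rho> F \<xi> P \<tau> (\<T>h l) (\<psi>h l)" for l by simp
  then have \<T>: "\<T>h l \<in> refinements refine \<T>\<^sub>0" and \<psi>h: "\<psi>h l \<in> X (\<T>h l)"
    and contr: "(norm (\<psi>\<^sub>s (\<T>h l) - \<psi>h l))\<^sup>2
      \<le> lam * (norm (\<psi>\<^sub>s (\<T>h l) - previous \<psi>_init \<psi>h l))\<^sup>2" for l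
    using adaptive_run_step[OF run lam(1), of l] by simp_all
  have marking: "\<M>h l \<subseteq> \<T>h l"
    "\<theta> * (estimator \<rho> (\<T>h l) (\<T>h l) (\<psi>h l))\<^sup>2 \<le> (estimator \<rho> (\<T>h l) (\<M>h l) (\<psi>h l))\<^sup>2"
    "\<T>h (Suc l) = refine (\<T>h l) (\<M>h l)" for l
  proof -
    have "\<forall>j\<le>l. \<not> stopping \<rho> F \<xi> P \<tau> (\<T>h j) (\<psi>h j)" using never by simp
    then have "\<M>h l \<subseteq> \<T>h l \<and>
        \<theta> * (estimator \<rho> (\<T>h l) (\<T>h l) (\<psi>h l))\<^sup>2 \<le> (estimator \<rho> (\<T>h l) (\<M>h l) (\<psi>h l))\<^sup>2 \<and>
        \<T>h (Suc l) = refine (\<T>h l) (\<M>h l)"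
      using run unfolding adaptive_run_def by blast
    then show "\<M>h l \<subseteq> \<T>h l"
      "\<theta> * (estimator \<rho> (\<T>h l) (\<T>h l) (\<psi>h l))\<^sup>2 \<le> (estimator \<rho> (\<T>h l) (\<M>h l) (\<psi>h l))\<^sup>2"
      "\<T>h (Suc l) = refine (\<T>h l) (\<M>h l)" by blast+
  qed
  have nested_run: "X (\<T>h l) \<subseteq> X (\<T>h (Suc l))" for l
  proof (rule nested[OF \<T>])
    show "\<T>h (Suc l) \<in> refinements refine (\<T>h l)"
      unfolding marking(3) by (rule refinements.step[OF refinements.self marking(1)])
  qed

  define d e where "d l = norm (\<psi>\<^sub>s (\<T>h (Suc l)) - \<psi>\<^sub>s (\<T>h l))"
    and "e l = norm (\<psi>\<^sub>s (\<T>h l) - \<psi>h l)" for l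
  define g where "g l = norm (\<psi>h (Suc l) - \<psi>h l)" for l
  define \<eta> where "\<eta> l = estimator \<rho> (\<T>h l) (\<T>h l) (\<psi>h l)" for l
  have d: "d \<longlonglongrightarrow> 0"
    unfolding d_def by (rule best_approximation_increments) (rule \<T>, rule nested_run)
  \<comment> \<open>The inner loop contracts the distance of the old iterate to the new best
    approximation; passing through the old best approximation costs \<open>d l\<close>.\<close>
  have "e (Suc l) \<le> sqrt lam * e l + sqrt lam * d l" for l
  proof -
    have "(norm (\<psi>\<^sub>s (\<T>h (Suc l)) - \<psi>h (Suc l)))\<^sup>2 \<le> lam * (norm (\<psi>\<^sub>s (\<T>h (Suc l)) - \<psi>h l))\<^sup>2"
      using contr[of "Suc l"] by (simp add: previous_def)
    then have "e (Suc l) \<le> sqrt (lam * (norm (\<psi>\<^sub>s (\<T>h (Suc l)) - \<psi>h l))\<^sup>2)"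
      unfolding e_def by (rule real_le_rsqrt)
    also have "\<dots> = sqrt lam * norm (\<psi>\<^sub>s (\<T>h (Suc l)) - \<psi>h l)"
      by (simp add: real_sqrt_mult)
    also have "\<dots> \<le> sqrt lam * (d l + e l)"
      using norm_triangle_ineq[of "\<psi>\<^sub>s (\<T>h (Suc l)) - \<psi>\<^sub>s (\<T>h l)" "\<psi>\<^sub>s (\<T>h l) - \<psi>h l"] lam
      by (intro mult_left_mono) (auto simp: d_def e_def)
    finally show ?thesis by (simp add: algebra_simps)
  qed
  then have e: "e \<longlonglongrightarrow> 0"
    by (rule perturbed_contraction_tendsto_0[rotated 3])
      (use lam in \<open>auto simp: e_def intro!: tendsto_mult_right_zero d\<close>)
  have "(\<lambda>l. e (Suc l) + d l + e l) \<longlonglongrightarrow> 0 + 0 + 0"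
    by (intro tendsto_add LIMSEQ_Suc e d)
  then have bound: "(\<lambda>l. e (Suc l) + d l + e l) \<longlonglongrightarrow> 0" by simp
  \<comment> \<open>The path from one iterate to the next goes through both best
    approximations.\<close>
  have "g l \<le> e (Suc l) + d l + e l" for l
  proof -
    let ?a = "\<psi>\<^sub>s (\<T>h (Suc l)) - \<psi>h (Suc l)" and ?b = "\<psi>\<^sub>s (\<T>h (Suc l)) - \<psi>\<^sub>s (\<T>h l)"
      and ?c = "\<psi>\<^sub>s (\<T>h l) - \<psi>h l"
    have "g l = norm (- ?a + ?b + ?c)" by (simp add: g_def)
    also have "\<dots> \<le> norm (- ?a + ?b) + norm ?c" by (rule norm_triangle_ineq)
    also have "\<dots> \<le> norm (- ?a) + norm ?b + norm ?c"
      by (intro add_right_mono norm_triangle_ineq)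
    finally show ?thesis unfolding d_def e_def norm_minus_cancel .
  qed
  then have "g \<longlonglongrightarrow> 0"
    by (intro tendsto_sandwich[OF _ _ tendsto_const bound] always_eventually allI)
      (simp_all add: g_def)
  then have Cg: "(\<lambda>l. C_stab * g l) \<longlonglongrightarrow> 0" by (rule tendsto_mult_right_zero)
  define \<kappa> where "\<kappa> = sqrt (1 - (1 - q_red) * \<theta>)"
  have "0 < (1 - q_red) * \<theta>" using \<theta> constants by simp
  moreover have "(1 - q_red) * \<theta> \<le> 1 * 1" using \<theta> constants by (intro mult_mono) auto
  ultimately have \<kappa>: "0 \<le> \<kappa>" "\<kappa> < 1" by (simp_all add: \<kappa>_def)
  have "\<eta> (Suc l) \<le> \<kappa> * \<eta> l + C_stab * g l" for l
    unfolding \<eta>_def \<kappa>_def g_def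
    using \<theta> by (intro estimator_reduction[OF \<T> marking(1,3) \<psi>h \<psi>h _ _ marking(2)]) simp_all
  then have \<eta>: "\<eta> \<longlonglongrightarrow> 0"
    by (rule perturbed_contraction_tendsto_0[rotated 3])
      (use \<kappa> Cg in \<open>auto simp: \<eta>_def estimator_def intro!: sum_nonneg\<close>)

  \<comment> \<open>The term \<open>C\<^sub>P * (e l)\<^sup>2\<close> dominates the algebraic part
    of the stopping quantity, so a value below \<open>\<tau>\<^sup>2\<close> contradicts
    \<open>never\<close>.\<close>
  have "(\<lambda>l. (\<eta> l)\<^sup>2 + C\<^sub>P * (e l)\<^sup>2) \<longlonglongrightarrow> 0\<^sup>2 + C\<^sub>P * 0\<^sup>2"
    by (intro tendsto_intros \<eta> e)
  then have "\<forall>\<^sub>F l in sequentially. (\<eta> l)\<^sup>2 + C\<^sub>P * (e l)\<^sup>2 < \<tau>\<^sup>2"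
    by (rule order_tendstoD) (use \<tau> in simp)
  then obtain l where "(\<eta> l)\<^sup>2 + C\<^sub>P * (e l)\<^sup>2 < \<tau>\<^sup>2"
    using eventually_happens'[OF sequentially_bot] by blast
  then have "stopping \<rho> F \<xi> P \<tau> (\<T>h l) (\<psi>h l)"
    using P_error_sq_equivalence(2)[OF \<T>[of l] \<psi>h[of l]]
    unfolding stopping_def \<eta>_def e_def by linarith
  with never show False by simp
qed

end

text \<open>The order of quantifiers expresses the dependence of \<open>C_stop\<close>: besides
  \<open>C_rel\<close> and \<open>C_stab\<close> only the preconditioner constant
  \<open>c\<^sub>P\<close> is fixed beforehand. Existence of accepted iterates is part of the
  conclusion, as it states that each inner loop ends.\<close>

theorem proposition11:
  fixes C_rel C_stab c\<^sub>P :: real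
  assumes "0 < C_rel" and "0 < C_stab" and "0 < c\<^sub>P"
  shows "\<exists>C_stop>0.
    \<forall>(refine :: 'a::euclidean_space mesh \<Rightarrow> 'a mesh \<Rightarrow> 'a mesh) (\<T>\<^sub>0 :: 'a mesh)
      (X :: 'a mesh \<Rightarrow> 'h::{real_inner, complete_space} set) (F :: 'h \<Rightarrow> real) (\<psi> :: 'h)
      (\<psi>\<^sub>s :: 'a mesh \<Rightarrow> 'h) (\<rho> :: 'a mesh \<Rightarrow> 'a set \<Rightarrow> 'h \<Rightarrow> real) (q_red :: real)
      (\<xi> :: 'a mesh \<Rightarrow> 'h list) (P :: 'a mesh \<Rightarrow> real mat) (C\<^sub>P :: real)
      (\<theta> :: real) (lam :: real) (\<tau> :: real) (\<psi>_init :: 'h)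
      (\<T>h :: nat \<Rightarrow> 'a mesh) (\<psi>h :: nat \<Rightarrow> 'h) (\<M>h :: nat \<Rightarrow> 'a mesh).
      pcg_framework refine \<T>\<^sub>0 X F \<psi> \<psi>\<^sub>s \<rho> C_stab q_red C_rel \<xi> P c\<^sub>P C\<^sub>P \<longrightarrow>
      0 < \<theta> \<longrightarrow> \<theta> \<le> 1 \<longrightarrow> 0 \<le> lam \<longrightarrow> lam < 1 \<longrightarrow> 0 < \<tau> \<longrightarrow> \<psi>_init \<in> X \<T>\<^sub>0 \<longrightarrow>
      adaptive_run refine \<T>\<^sub>0 F \<psi>\<^sub>s \<rho> \<xi> P \<theta> lam \<tau> \<psi>_init \<T>h \<psi>h \<M>h \<longrightarrow>
      (\<exists>l.
        (\<forall>j\<le>l. \<exists>k. pcg_accepted F (\<psi>\<^sub>s (\<T>h j)) (\<xi> (\<T>h j)) (P (\<T>h j)) lam (previous \<psi>_init \<psi>h j) k) \<and>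
        stopping \<rho> F \<xi> P \<tau> (\<T>h l) (\<psi>h l) \<and>
        (\<forall>j<l. \<not> stopping \<rho> F \<xi> P \<tau> (\<T>h j) (\<psi>h j)) \<and>
        \<T>h l \<in> refinements refine \<T>\<^sub>0 \<and> \<psi>h l \<in> X (\<T>h l) \<and>
        norm (\<psi> - \<psi>h l) \<le> C_stop * \<tau>)"
proof (intro exI[of _ "C_rel + (1 + C_rel * C_stab) / sqrt c\<^sub>P"] conjI allI impI)
  have "0 < (1 + C_rel * C_stab) / sqrt c\<^sub>P"
    using assms by (intro divide_pos_pos add_pos_pos mult_pos_pos) auto
  then show "0 < C_rel + (1 + C_rel * C_stab) / sqrt c\<^sub>P"
    using assms by simp
next
  fix refine :: "'a mesh \<Rightarrow> 'a mesh \<Rightarrow> 'a mesh" and \<T>\<^sub>0 :: "'a mesh"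
    and X :: "'a mesh \<Rightarrow> 'h set" and F \<psi> \<psi>\<^sub>s \<rho> q_red \<xi> P C\<^sub>P and \<theta> lam \<tau> :: real and \<psi>_init \<T>h \<psi>h \<M>h
  assume framework: "pcg_framework refine \<T>\<^sub>0 X F \<psi> \<psi>\<^sub>s \<rho> C_stab q_red C_rel \<xi> P c\<^sub>P C\<^sub>P"
    and params: "0 < \<theta>" "\<theta> \<le> 1" "0 \<le> lam" "lam < 1" "0 < \<tau>" "\<psi>_init \<in> X \<T>\<^sub>0"
    and run: "adaptive_run refine \<T>\<^sub>0 F \<psi>\<^sub>s \<rho> \<xi> P \<theta> lam \<tau> \<psi>_init \<T>h \<psi>h \<M>h"
  interpret pcg_framework refine \<T>\<^sub>0 X F \<psi> \<psi>\<^sub>s \<rho> C_stab q_red C_rel \<xi> P c\<^sub>P C\<^sub>P by (rule framework)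
  let ?stop = "\<lambda>l. stopping \<rho> F \<xi> P \<tau> (\<T>h l) (\<psi>h l)"
  \<comment> \<open>The output is the first stopping index, so all entries up to it obey the rules
    of the run.\<close>
  define l where "l = (LEAST l. ?stop l)"
  have stop: "?stop l"
    unfolding l_def by (rule LeastI_ex[OF adaptive_run_stops[OF run params(1-5)]])
  have running: "\<forall>j<l. \<not> ?stop j"
    unfolding l_def using not_less_Least by blast
  have \<T>: "\<T>h j \<in> refinements refine \<T>\<^sub>0" and \<psi>h: "\<psi>h j \<in> X (\<T>h j)" if "j \<le> l" for j
    using adaptive_run_step[OF run params(3)] running that by (meson order_less_le_trans)+
  show "\<exists>l. (\<forall>j\<le>l. \<exists>k. pcg_accepted F (\<psi>\<^sub>s (\<T>h j)) (\<xi> (\<T>h j)) (P (\<T>h j)) lam (previous \<psi>_init \<psi>h j) k) \<and>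
      ?stop l \<and> (\<forall>j<l. \<not> ?stop j) \<and> \<T>h l \<in> refinements refine \<T>\<^sub>0 \<and> \<psi>h l \<in> X (\<T>h l) \<and>
      norm (\<psi> - \<psi>h l) \<le> (C_rel + (1 + C_rel * C_stab) / sqrt c\<^sub>P) * \<tau>"
  proof (intro exI[of _ l] conjI)
    show "\<forall>j\<le>l. \<exists>k. pcg_accepted F (\<psi>\<^sub>s (\<T>h j)) (\<xi> (\<T>h j)) (P (\<T>h j)) lam (previous \<psi>_init \<psi>h j) k"
      using pcg_accepted_exists[OF \<T> params(3)] by simp
  qed (use stop running \<T> \<psi>h error_le_stopping_quantity[OF \<T> \<psi>h params(5) stop] in simp_all)
qed

end
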